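(* Let $G$ be a finite group with a non-central element of odd order. Then $\mathcal G(\mathcal C(G))$ does not embed in the wreath product of a finite group with a torsion-free group.
   Context: The Cayley machine $\mathcal C(G)$ of a finite group $G$ is the Mealy automaton with state set and alphabet $G$ which, in state $g$ on input $a$, outputs $ga$ and moves to state $ga$. State $g$ computes the bijection $\mathcal C(G)_g(a_0,a_1,\dots,a_m)=(ga_0,ga_0a_1,\dots,ga_0a_1\cdots a_m)$ of the set $G^*$ of words over $G$. $\mathcal G(\mathcal C(G))$ is the group of bijections of $G^*$ generated by the $\mathcal C(G)_g$, $g\in G$. The wreath product of $K$ with $H$ means the restricted wreath product $K\,\mathrm{wr}\,H=\left(\bigoplus_HK\right)\rtimes H$, with $H$ acting by translation of coordinates. *)

theory Defs
  imports "HOL-Algebra.Algebra"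
begin

section \<open>Automaton groups\<close>

record ('q, 'a) mealy =
  states :: "'q set"
  alphabet :: "'a set"
  emit :: "'q \<Rightarrow> 'a \<Rightarrow> 'a"
  next_state :: "'q \<Rightarrow> 'a \<Rightarrow> 'q"

primrec mealy_run :: "('q, 'a) mealy \<Rightarrow> 'q \<Rightarrow> 'a list \<Rightarrow> 'a list" where
  "mealy_run M q [] = []"
| "mealy_run M q (a # w) = emit M q a # mealy_run M (next_state M q a) w"

definition mealy_function :: "('q, 'a) mealy \<Rightarrow> 'q \<Rightarrow> 'a list \<Rightarrow> 'a list" where
  "mealy_function M q = restrict (mealy_run M q) (lists (alphabet M))"

text \<open>Since \<^const>\<open>subgroup_generated\<close> discards generators outside the carrier, this is the
  automaton group only when every state computes a bijection of the set of words. Lemma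
  \<open>cayley_machine_Bij\<close> below shows that this holds for the Cayley machine.\<close>

definition automaton_group :: "('q, 'a) mealy \<Rightarrow> ('a list \<Rightarrow> 'a list) monoid" where
  "automaton_group M =
     subgroup_generated (BijGroup (lists (alphabet M))) (mealy_function M ` states M)"

definition cayley_machine :: "('a, 'm) monoid_scheme \<Rightarrow> ('a, 'a) mealy" where
  "cayley_machine G =
     \<lparr>states = carrier G, alphabet = carrier G, emit = (\<otimes>\<^bsub>G\<^esub>), next_state = (\<otimes>\<^bsub>G\<^esub>)\<rparr>"

lemma cayley_machine_simps [simp]:
  "states (cayley_machine G) = carrier G"
  "alphabet (cayley_machine G) = carrier G"
  "emit (cayley_machine G) = (\<otimes>\<^bsub>G\<^esub>)"
  "next_state (cayley_machine G) = (\<otimes>\<^bsub>G\<^esub>)"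
  by (simp_all add: cayley_machine_def)

lemma length_mealy_run [simp]: "length (mealy_run M q w) = length w"
  by (induction w arbitrary: q) auto

lemma cayley_machine_nth:
  "i < length w \<Longrightarrow> mealy_run (cayley_machine G) g w ! i = foldl (\<otimes>\<^bsub>G\<^esub>) g (take (Suc i) w)"
proof (induction w arbitrary: g i)
  case (Cons a w)
  then show ?case by (cases i) auto
qed simp

lemma (in group) cayley_machine_run_lists:
  "g \<in> carrier G \<Longrightarrow> w \<in> lists (carrier G) \<Longrightarrow>
     mealy_run (cayley_machine G) g w \<in> lists (carrier G)"
  by (induction w arbitrary: g) auto

lemma (in group) cayley_machine_run_inj:
  "g \<in> carrier G \<Longrightarrow> v \<in> lists (carrier G) \<Longrightarrow> w \<in> lists (carrier G) \<Longrightarrow>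
     mealy_run (cayley_machine G) g v = mealy_run (cayley_machine G) g w \<Longrightarrow> v = w"
proof (induction v arbitrary: g w)
  case Nil
  then show ?case by (cases w) auto
next
  case (Cons a v)
  then obtain b u where w: "w = b # u" by (cases w) auto
  with Cons.prems have "a = b" by auto
  moreover from this Cons.prems w have "v = u"
    by (intro Cons.IH[of "g \<otimes> a" u]) auto
  ultimately show ?case by (simp add: w)
qed

lemma (in group) cayley_machine_run_surj:
  "g \<in> carrier G \<Longrightarrow> w \<in> lists (carrier G) \<Longrightarrow>
     \<exists>v\<in>lists (carrier G). mealy_run (cayley_machine G) g v = w"
proof (induction w arbitrary: g)
  case Nil
  then show ?case by (intro bexI[of _ "[]"]) auto
next
  case (Cons a w)
  then obtain v where v: "v \<in> lists (carrier G)" "mealy_run (cayley_machine G) a v = w"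
    by auto
  from Cons.prems have "g \<otimes> (inv g \<otimes> a) = a"
    by (simp flip: m_assoc)
  with Cons.prems v show ?case
    by (intro bexI[of _ "(inv g \<otimes> a) # v"]) auto
qed

lemma (in group) cayley_machine_Bij:
  assumes "g \<in> carrier G"
  shows "mealy_function (cayley_machine G) g \<in> carrier (BijGroup (lists (carrier G)))"
proof -
  have "bij_betw (mealy_run (cayley_machine G) g) (lists (carrier G)) (lists (carrier G))"
  proof (rule bij_betwI')
    fix v w assume "v \<in> lists (carrier G)" "w \<in> lists (carrier G)"
    then show "(mealy_run (cayley_machine G) g v = mealy_run (cayley_machine G) g w) = (v = w)"
      using cayley_machine_run_inj[OF assms] by metis
  next
    fix v assume "v \<in> lists (carrier G)"
    then show "mealy_run (cayley_machine G) g v \<in> lists (carrier G)"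
      by (rule cayley_machine_run_lists[OF assms])
  next
    fix w assume "w \<in> lists (carrier G)"
    then show "\<exists>v\<in>lists (carrier G). w = mealy_run (cayley_machine G) g v"
      using cayley_machine_run_surj[OF assms] by metis
  qed
  then show ?thesis
    by (simp add: BijGroup_def Bij_def mealy_function_def del: in_lists_conv_set)
qed

section \<open>Restricted wreath products\<close>

definition semidirect_product ::
    "('n, 'k) monoid_scheme \<Rightarrow> ('h, 'l) monoid_scheme \<Rightarrow> ('h \<Rightarrow> 'n \<Rightarrow> 'n) \<Rightarrow> ('n \<times> 'h) monoid" where
  "semidirect_product N H \<alpha> =
     \<lparr>carrier = carrier N \<times> carrier H,
      monoid.mult = \<lambda>(n, h) (n', h'). (n \<otimes>\<^bsub>N\<^esub> \<alpha> h n', h \<otimes>\<^bsub>H\<^esub> h'),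
      one = (\<one>\<^bsub>N\<^esub>, \<one>\<^bsub>H\<^esub>)\<rparr>"

definition translate :: "('h, 'l) monoid_scheme \<Rightarrow> 'h \<Rightarrow> ('h \<Rightarrow> 'k) \<Rightarrow> 'h \<Rightarrow> 'k" where
  "translate H h f = (\<lambda>x\<in>carrier H. f (inv\<^bsub>H\<^esub> h \<otimes>\<^bsub>H\<^esub> x))"

definition wreath_product ::
    "('k, 'm) monoid_scheme \<Rightarrow> ('h, 'l) monoid_scheme \<Rightarrow> (('h \<Rightarrow> 'k) \<times> 'h) monoid" where
  "wreath_product K H = semidirect_product (sum_group (carrier H) (\<lambda>_. K)) H (translate H)"

lemma group_semidirect_product:
  assumes N: "group N" and H: "group H"
    and hom: "\<And>h. h \<in> carrier H \<Longrightarrow> \<alpha> h \<in> hom N N"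
    and one: "\<And>n. n \<in> carrier N \<Longrightarrow> \<alpha> \<one>\<^bsub>H\<^esub> n = n"
    and comp: "\<And>h h' n. h \<in> carrier H \<Longrightarrow> h' \<in> carrier H \<Longrightarrow> n \<in> carrier N \<Longrightarrow>
                 \<alpha> (h \<otimes>\<^bsub>H\<^esub> h') n = \<alpha> h (\<alpha> h' n)"
  shows "group (semidirect_product N H \<alpha>)"
proof -
  interpret N: group N by fact
  interpret H: group H by fact
  have clo: "\<alpha> h n \<in> carrier N" if "h \<in> carrier H" "n \<in> carrier N" for h n
    using hom that by (auto simp: hom_def)
  have mult: "\<alpha> h (n \<otimes>\<^bsub>N\<^esub> n') = \<alpha> h n \<otimes>\<^bsub>N\<^esub> \<alpha> h n'"
    if "h \<in> carrier H" "n \<in> carrier N" "n' \<in> carrier N" for h n n'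
    using hom that by (auto simp: hom_def)
  show ?thesis
  proof (rule groupI)
    fix x assume "x \<in> carrier (semidirect_product N H \<alpha>)"
    then obtain n h where x: "x = (n, h)" "n \<in> carrier N" "h \<in> carrier H"
      by (auto simp: semidirect_product_def)
    have "(\<alpha> (inv\<^bsub>H\<^esub> h) (inv\<^bsub>N\<^esub> n), inv\<^bsub>H\<^esub> h) \<otimes>\<^bsub>semidirect_product N H \<alpha>\<^esub> x
            = \<one>\<^bsub>semidirect_product N H \<alpha>\<^esub>"
      using x mult[of "inv\<^bsub>H\<^esub> h" "inv\<^bsub>N\<^esub> n" n] mult[of "inv\<^bsub>H\<^esub> h" "\<one>\<^bsub>N\<^esub>" "\<one>\<^bsub>N\<^esub>"]
        clo[of "inv\<^bsub>H\<^esub> h" "\<one>\<^bsub>N\<^esub>"]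
      by (simp add: semidirect_product_def)
    with x show "\<exists>y\<in>carrier (semidirect_product N H \<alpha>).
        y \<otimes>\<^bsub>semidirect_product N H \<alpha>\<^esub> x = \<one>\<^bsub>semidirect_product N H \<alpha>\<^esub>"
      by (intro bexI[of _ "(\<alpha> (inv\<^bsub>H\<^esub> h) (inv\<^bsub>N\<^esub> n), inv\<^bsub>H\<^esub> h)"])
        (auto simp: semidirect_product_def clo)
  qed (auto simp: semidirect_product_def clo mult one comp N.m_assoc H.m_assoc)
qed

lemma group_wreath_product:
  assumes K: "group K" and H: "group H"
  shows "group (wreath_product K H)"
proof -
  interpret K: group K by fact
  interpret H: group H by fact
  let ?N = "sum_group (carrier H) (\<lambda>_. K)"
  have car: "carrier ?N =
      {f \<in> carrier H \<rightarrow>\<^sub>E carrier K. finite {x \<in> carrier H. f x \<noteq> \<one>\<^bsub>K\<^esub>}}"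
    by (rule carrier_sum_group) (rule K)
  have clo: "translate H h f \<in> carrier ?N" if h: "h \<in> carrier H" and f: "f \<in> carrier ?N" for h f
  proof -
    have "{x \<in> carrier H. translate H h f x \<noteq> \<one>\<^bsub>K\<^esub>}
            \<subseteq> (\<lambda>y. h \<otimes>\<^bsub>H\<^esub> y) ` {x \<in> carrier H. f x \<noteq> \<one>\<^bsub>K\<^esub>}"
    proof
      fix x assume x: "x \<in> {x \<in> carrier H. translate H h f x \<noteq> \<one>\<^bsub>K\<^esub>}"
      then have "x = h \<otimes>\<^bsub>H\<^esub> (inv\<^bsub>H\<^esub> h \<otimes>\<^bsub>H\<^esub> x)"
        using h by (simp flip: H.m_assoc)
      with x h show "x \<in> (\<lambda>y. h \<otimes>\<^bsub>H\<^esub> y) ` {x \<in> carrier H. f x \<noteq> \<one>\<^bsub>K\<^esub>}"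
        by (intro image_eqI[where x = "inv\<^bsub>H\<^esub> h \<otimes>\<^bsub>H\<^esub> x"]) (auto simp: translate_def)
    qed
    then have "finite {x \<in> carrier H. translate H h f x \<noteq> \<one>\<^bsub>K\<^esub>}"
      using f car by (auto intro: finite_subset)
    with h f show ?thesis
      unfolding car by (auto simp: translate_def PiE_iff)
  qed
  show ?thesis
    unfolding wreath_product_def
  proof (rule group_semidirect_product)
    show "group ?N" by (simp add: K)
    show "translate H h \<in> hom ?N ?N" if "h \<in> carrier H" for h
      using that clo by (auto simp: hom_def translate_def fun_eq_iff)
    show "translate H \<one>\<^bsub>H\<^esub> f = f" if "f \<in> carrier ?N" for f
      using that by (auto simp: car translate_def fun_eq_iff PiE_iff extensional_def)
    show "translate H (h \<otimes>\<^bsub>H\<^esub> h') f = translate H h (translate H h' f)"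
      if "h \<in> carrier H" "h' \<in> carrier H" for h h' f
      using that by (auto simp: translate_def fun_eq_iff H.inv_mult_group H.m_assoc)
  qed (rule H)
qed

section \<open>Group-theoretic hypotheses\<close>

definition group_center :: "('a, 'm) monoid_scheme \<Rightarrow> 'a set" where
  "group_center G = {z \<in> carrier G. \<forall>y\<in>carrier G. z \<otimes>\<^bsub>G\<^esub> y = y \<otimes>\<^bsub>G\<^esub> z}"

definition torsion_free :: "('a, 'm) monoid_scheme \<Rightarrow> bool" where
  "torsion_free G \<longleftrightarrow>
     (\<forall>x\<in>carrier G. \<forall>n::nat. 0 < n \<longrightarrow> x [^]\<^bsub>G\<^esub> n = \<one>\<^bsub>G\<^esub> \<longrightarrow> x = \<one>\<^bsub>G\<^esub>)"

end

theory Submission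
  imports Defs
begin

text \<open>Write \<open>t\<close> for the function of the state \<open>\<one>\<close> and \<open>\<lambda>\<^sub>g = t\<inverse> \<C>\<^sub>g\<close>, which multiplies the first
  letter of a word by \<open>g\<close> on the left. Since \<open>t\<close> fixes all words of length one, every conjugate
  \<open>t\<^sup>n \<lambda>\<^sub>g t\<^sup>-\<^sup>n\<close> acts on them like \<open>g\<close>, so it does not commute with \<open>\<lambda>\<^sub>h\<close> when \<open>g\<close> and \<open>h\<close> do not commute.
  In a wreath product \<open>K wr H\<close> as in the theorem, however, the torsion elements lie in the base group,
  and an element of infinite order has an \<open>H\<close>-component of infinite order. Conjugation by a suitable
  power of it moves the finite support of one torsion element off the support of another one, and
  then the two commute.\<close>

section \<open>Torsion in wreath products\<close>

lemma carrier_wreath_product: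
  assumes "group K"
  shows "carrier (wreath_product K H) =
    {f \<in> carrier H \<rightarrow>\<^sub>E carrier K. finite {x \<in> carrier H. f x \<noteq> \<one>\<^bsub>K\<^esub>}} \<times> carrier H"
  using assms by (simp add: wreath_product_def semidirect_product_def carrier_sum_group)

lemma mult_wreath_product:
  "(f, h) \<otimes>\<^bsub>wreath_product K H\<^esub> (f', h') =
    (\<lambda>x\<in>carrier H. f x \<otimes>\<^bsub>K\<^esub> f' (inv\<^bsub>H\<^esub> h \<otimes>\<^bsub>H\<^esub> x), h \<otimes>\<^bsub>H\<^esub> h')"
  by (auto simp: wreath_product_def semidirect_product_def translate_def fun_eq_iff)

lemma one_wreath_product:
  "\<one>\<^bsub>wreath_product K H\<^esub> = (\<lambda>x\<in>carrier H. \<one>\<^bsub>K\<^esub>, \<one>\<^bsub>H\<^esub>)"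
  by (simp add: wreath_product_def semidirect_product_def)

lemma snd_hom_wreath_product:
  assumes "group K" and "group H"
  shows "group_hom (wreath_product K H) H snd"
  unfolding group_hom_def group_hom_axioms_def hom_def
  using assms
  by (auto simp: group_wreath_product carrier_wreath_product mult_wreath_product)

text \<open>The projection to \<open>H\<close> sends torsion to torsion, and \<open>H\<close> has
  only the trivial one.\<close>

lemma snd_eq_one_of_torsion:
  assumes K: "group K" and H: "group H" and tf: "torsion_free H"
    and x: "x \<in> carrier (wreath_product K H)"
    and n: "0 < (n::nat)" "x [^]\<^bsub>wreath_product K H\<^esub> n = \<one>\<^bsub>wreath_product K H\<^esub>"
  shows "snd x = \<one>\<^bsub>H\<^esub>"
proof -
  interpret snd: group_hom "wreath_product K H" H snd
    by (rule snd_hom_wreath_product[OF K H])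
  have "snd x [^]\<^bsub>H\<^esub> n = \<one>\<^bsub>H\<^esub>"
    using snd.hom_nat_pow[OF x, of n] n by simp
  then show ?thesis
    using tf n(1) snd.hom_closed[OF x] by (auto simp: torsion_free_def)
qed

lemma pow_wreath_product_base:
  assumes K: "group K" and H: "group H"
    and f: "(f, \<one>\<^bsub>H\<^esub>) \<in> carrier (wreath_product K H)"
  shows "(f, \<one>\<^bsub>H\<^esub>) [^]\<^bsub>wreath_product K H\<^esub> (n::nat) = (\<lambda>x\<in>carrier H. f x [^]\<^bsub>K\<^esub> n, \<one>\<^bsub>H\<^esub>)"
proof -
  interpret K: group K by fact
  interpret H: group H by fact
  show ?thesis
    by (induction n) (auto simp: one_wreath_product mult_wreath_product fun_eq_iff nat_pow_def)
qed

text \<open>Powers in the base group are taken coordinatewise, so its exponent divides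
  \<open>order K\<close>. Hence an element of infinite order lies outside the base group.\<close>

lemma base_torsion:
  assumes K: "group K" and finK: "finite (carrier K)" and H: "group H"
    and x: "x \<in> carrier (wreath_product K H)" "snd x = \<one>\<^bsub>H\<^esub>"
  shows "x [^]\<^bsub>wreath_product K H\<^esub> order K = \<one>\<^bsub>wreath_product K H\<^esub>"
proof -
  interpret K: group K by fact
  obtain f where f: "x = (f, \<one>\<^bsub>H\<^esub>)" using x(2) by (cases x) simp
  have "f y \<in> carrier K" if "y \<in> carrier H" for y
    using x(1) that unfolding f carrier_wreath_product[OF K] by auto
  then show ?thesis
    using pow_wreath_product_base[OF K H] x(1) K.pow_order_eq_1
    by (auto simp: f one_wreath_product fun_eq_iff)
qed

section \<open>Moving supports apart by conjugation\<close>

lemma exists_pow_notin_finite: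
  assumes H: "group H" and tf: "torsion_free H"
    and h: "h \<in> carrier H" "h \<noteq> \<one>\<^bsub>H\<^esub>" and A: "finite A"
  shows "\<exists>n::nat. h [^]\<^bsub>H\<^esub> n \<notin> A"
proof -
  interpret H: group H by fact
  have "inj (\<lambda>n::nat. h [^]\<^bsub>H\<^esub> n)"
  proof (rule linorder_injI)
    fix m n :: nat assume "m < n"
    show "h [^]\<^bsub>H\<^esub> m \<noteq> h [^]\<^bsub>H\<^esub> n"
    proof
      assume "h [^]\<^bsub>H\<^esub> m = h [^]\<^bsub>H\<^esub> n"
      then have "h [^]\<^bsub>H\<^esub> (n - m) = \<one>\<^bsub>H\<^esub>"
        using H.pow_eq_div2[OF h(1), of n m] by simp
      with tf h \<open>m < n\<close> show False by (auto simp: torsion_free_def)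
    qed
  qed
  then have "infinite (range (\<lambda>n::nat. h [^]\<^bsub>H\<^esub> n))"
    by (rule range_inj_infinite)
  with A show ?thesis by (meson finite_subset image_subsetI)
qed

text \<open>Here \<open>z\<close> is the conjugate of \<open>x\<close> by a power of
  \<open>t\<close>. Both \<open>x\<close> and \<open>y\<close> lie in the base group; conjugation by
  \<open>t [^] n\<close> translates the support of \<open>x\<close> by \<open>snd t [^] n\<close>,
  and base elements with disjoint supports commute.\<close>

lemma conjugate_commutes_with_torsion:
  assumes K: "group K" and finK: "finite (carrier K)" and H: "group H" and tf: "torsion_free H"
  defines "W \<equiv> wreath_product K H"
  assumes t: "t \<in> carrier W" "\<And>n::nat. 0 < n \<Longrightarrow> t [^]\<^bsub>W\<^esub> n \<noteq> \<one>\<^bsub>W\<^esub>"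
    and x: "x \<in> carrier W" "0 < (k::nat)" "x [^]\<^bsub>W\<^esub> k = \<one>\<^bsub>W\<^esub>"
    and y: "y \<in> carrier W" "0 < (l::nat)" "y [^]\<^bsub>W\<^esub> l = \<one>\<^bsub>W\<^esub>"
  obtains n :: nat and z where "z \<in> carrier W" "z \<otimes>\<^bsub>W\<^esub> t [^]\<^bsub>W\<^esub> n = t [^]\<^bsub>W\<^esub> n \<otimes>\<^bsub>W\<^esub> x"
    "z \<otimes>\<^bsub>W\<^esub> y = y \<otimes>\<^bsub>W\<^esub> z"
proof -
  interpret K: group K by fact
  interpret H: group H by fact
  interpret snd: group_hom W H snd
    unfolding W_def by (rule snd_hom_wreath_product[OF K H])
  note carW = carrier_wreath_product[OF K, of H, folded W_def]
  note multW = mult_wreath_product[where K = K and H = H, folded W_def]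
  obtain b where b: "x = (b, \<one>\<^bsub>H\<^esub>)"
    using snd_eq_one_of_torsion[OF K H tf] x unfolding W_def by (metis prod.collapse)
  obtain d where d: "y = (d, \<one>\<^bsub>H\<^esub>)"
    using snd_eq_one_of_torsion[OF K H tf] y unfolding W_def by (metis prod.collapse)
  have "0 < order K" using finK K.order_gt_0_iff_finite by simp
  then have tne: "snd t \<noteq> \<one>\<^bsub>H\<^esub>"
    using base_torsion[OF K finK H] t unfolding W_def by blast
  define B where "B = {v \<in> carrier H. b v \<noteq> \<one>\<^bsub>K\<^esub>}"
  define D where "D = {v \<in> carrier H. d v \<noteq> \<one>\<^bsub>K\<^esub>}"
  have "finite B" "finite D"
    using x(1) y(1) by (auto simp: b d B_def D_def carW)
  \<comment> \<open>If the translate of \<open>B\<close> by some \<open>h\<close> meets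
    \<open>D\<close> in \<open>v\<close>, then \<open>h\<close> is \<open>v\<close> times the
    inverse of some \<open>w\<close> in \<open>B\<close>. These are the finitely many translations
    to avoid.\<close>
  then have "finite ((\<lambda>(v, w). v \<otimes>\<^bsub>H\<^esub> inv\<^bsub>H\<^esub> w) ` (D \<times> B))" by simp
  then obtain n :: nat where n: "snd t [^]\<^bsub>H\<^esub> n \<notin> (\<lambda>(v, w). v \<otimes>\<^bsub>H\<^esub> inv\<^bsub>H\<^esub> w) ` (D \<times> B)"
    using exists_pow_notin_finite[OF H tf snd.hom_closed[OF t(1)] tne] by blast
  obtain f h where fh: "t [^]\<^bsub>W\<^esub> n = (f, h)" by (cases "t [^]\<^bsub>W\<^esub> n")
  have u: "(f, h) \<in> carrier W" using snd.G.nat_pow_closed[OF t(1)] fh by metis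
  have h: "h \<in> carrier H" "h = snd t [^]\<^bsub>H\<^esub> n"
    using u snd.hom_nat_pow[OF t(1), of n] by (auto simp: fh carW)
  define z where "z = (f, h) \<otimes>\<^bsub>W\<^esub> x \<otimes>\<^bsub>W\<^esub> inv\<^bsub>W\<^esub> (f, h)"
  have zW: "z \<in> carrier W" using u x(1) by (simp add: z_def)
  have zu: "z \<otimes>\<^bsub>W\<^esub> (f, h) = (f, h) \<otimes>\<^bsub>W\<^esub> x"
    using u x(1) by (simp add: z_def snd.G.m_assoc)
  have "snd z = \<one>\<^bsub>H\<^esub>"
    using u x(1) h(1) snd.hom_mult[OF u x(1)] snd.hom_inv[OF u] by (simp add: z_def b)
  then obtain c where c: "z = (c, \<one>\<^bsub>H\<^esub>)" by (cases z) simp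
  have disj: "c v = \<one>\<^bsub>K\<^esub> \<or> d v = \<one>\<^bsub>K\<^esub>" if v: "v \<in> carrier H" for v
  proof (rule disjCI)
    assume "d v \<noteq> \<one>\<^bsub>K\<^esub>"
    have hv: "v \<otimes>\<^bsub>H\<^esub> inv\<^bsub>H\<^esub> (inv\<^bsub>H\<^esub> h \<otimes>\<^bsub>H\<^esub> v) = h"
      using v h(1) by (simp add: H.inv_mult_group flip: H.m_assoc)
    have "inv\<^bsub>H\<^esub> h \<otimes>\<^bsub>H\<^esub> v \<notin> B"
    proof
      assume "inv\<^bsub>H\<^esub> h \<otimes>\<^bsub>H\<^esub> v \<in> B"
      moreover have "v \<in> D" using v \<open>d v \<noteq> \<one>\<^bsub>K\<^esub>\<close> by (simp add: D_def)
      ultimately have "h \<in> (\<lambda>(v, w). v \<otimes>\<^bsub>H\<^esub> inv\<^bsub>H\<^esub> w) ` (D \<times> B)"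
        using hv by force
      with n h(2) show False by simp
    qed
    then have bv: "b (inv\<^bsub>H\<^esub> h \<otimes>\<^bsub>H\<^esub> v) = \<one>\<^bsub>K\<^esub>"
      using v h(1) by (simp add: B_def)
    have "f v \<in> carrier K" "c v \<in> carrier K"
      using u zW v by (auto simp: carW c)
    \<comment> \<open>This is coordinate \<open>v\<close> of \<open>zu\<close>. With
      \<open>bv\<close> it lets \<open>f v\<close> be cancelled, although \<open>K\<close> need not
      be abelian.\<close>
    moreover have "c v \<otimes>\<^bsub>K\<^esub> f v = f v \<otimes>\<^bsub>K\<^esub> b (inv\<^bsub>H\<^esub> h \<otimes>\<^bsub>H\<^esub> v)"
      using zu v by (auto simp: c b multW dest: fun_cong[where x = v])
    ultimately show "c v = \<one>\<^bsub>K\<^esub>" by (simp add: bv)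
  qed
  have "z \<otimes>\<^bsub>W\<^esub> y = y \<otimes>\<^bsub>W\<^esub> z"
  proof -
    have "c v \<otimes>\<^bsub>K\<^esub> d v = d v \<otimes>\<^bsub>K\<^esub> c v" if v: "v \<in> carrier H" for v
    proof -
      have "c v \<in> carrier K" "d v \<in> carrier K"
        using zW y(1) v by (auto simp: carW c d)
      then show ?thesis using disj[OF v] by auto
    qed
    then show ?thesis by (auto simp: c d multW fun_eq_iff)
  qed
  then show thesis using that zW zu fh by metis
qed

section \<open>The group of the Cayley machine\<close>

context group
begin

abbreviation word_group :: "('a list \<Rightarrow> 'a list) monoid" where
  "word_group \<equiv> BijGroup (lists (carrier G))"

abbreviation cayley_fun :: "'a \<Rightarrow> 'a list \<Rightarrow> 'a list" where
  "cayley_fun \<equiv> mealy_function (cayley_machine G)"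

text \<open>This is the \<open>\<lambda>\<^sub>g\<close> of the overview. Being a quotient of two
  generators, it lies in the automaton group by construction; its action on the first letter is
  derived below.\<close>

definition first_letter_mult :: "'a \<Rightarrow> 'a list \<Rightarrow> 'a list" where
  "first_letter_mult g = inv\<^bsub>word_group\<^esub> (cayley_fun \<one>) \<otimes>\<^bsub>word_group\<^esub> cayley_fun g"

lemma mult_word_group:
  assumes "u \<in> carrier word_group" "v \<in> carrier word_group" "w \<in> lists (carrier G)"
  shows "(u \<otimes>\<^bsub>word_group\<^esub> v) w = u (v w)"
  using assms by (simp add: BijGroup_def compose_def)

lemma word_group_closed:
  assumes "u \<in> carrier word_group" "w \<in> lists (carrier G)"
  shows "u w \<in> lists (carrier G)"
  using assms by (auto simp: BijGroup_def Bij_def dest: bij_betwE)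

lemma word_group_inj:
  assumes "u \<in> carrier word_group" "v \<in> lists (carrier G)" "w \<in> lists (carrier G)" "u v = u w"
  shows "v = w"
  using assms by (auto simp: BijGroup_def Bij_def bij_betw_def dest: inj_onD)

lemma word_group_eqI:
  assumes "u \<in> carrier word_group" "v \<in> carrier word_group"
    "\<And>w. w \<in> lists (carrier G) \<Longrightarrow> u w = v w"
  shows "u = v"
  using assms extensionalityI[of u "lists (carrier G)" v] by (simp add: BijGroup_def Bij_def del: in_lists_conv_set)

section \<open>Action of the quotients of generators on words\<close>

lemma first_letter_mult_closed:
  assumes "g \<in> carrier G"
  shows "first_letter_mult g \<in> carrier word_group"
  using assms cayley_machine_Bij group_BijGroup
  by (auto simp: first_letter_mult_def intro!: group.is_monoid monoid.m_closed group.inv_closed)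

text \<open>Removes the inverse from the definition: since \<open>cayley_fun \<one>\<close> is
  injective, this equation determines \<open>first_letter_mult g w\<close>.\<close>

lemma cayley_fun_first_letter_mult:
  assumes g: "g \<in> carrier G" and w: "w \<in> lists (carrier G)"
  shows "cayley_fun \<one> (first_letter_mult g w) = cayley_fun g w"
proof -
  interpret S: group word_group by (rule group_BijGroup)
  have "cayley_fun \<one> \<otimes>\<^bsub>word_group\<^esub> first_letter_mult g = cayley_fun g"
    using g by (simp add: first_letter_mult_def cayley_machine_Bij flip: S.m_assoc)
  then show ?thesis
    using mult_word_group[OF cayley_machine_Bij[OF one_closed] first_letter_mult_closed[OF g] w]
    by simp
qed

text \<open>State \<open>\<one>\<close> on letter \<open>g \<otimes> a\<close> and state
  \<open>g\<close> on letter \<open>a\<close> output the same letter and enter the same state, so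
  they treat the tail \<open>w\<close> alike.\<close>

lemma first_letter_mult_apply:
  assumes g: "g \<in> carrier G" and w: "a # w \<in> lists (carrier G)"
  shows "first_letter_mult g (a # w) = (g \<otimes> a) # w"
proof (rule word_group_inj[OF cayley_machine_Bij[OF one_closed]])
  show "first_letter_mult g (a # w) \<in> lists (carrier G)"
    using word_group_closed[OF first_letter_mult_closed[OF g] w] .
  show "(g \<otimes> a) # w \<in> lists (carrier G)" using g w by auto
  show "cayley_fun \<one> (first_letter_mult g (a # w)) = cayley_fun \<one> ((g \<otimes> a) # w)"
    unfolding cayley_fun_first_letter_mult[OF g w]
    using g w by (auto simp: mealy_function_def)
qed

lemma first_letter_mult_Nil:
  assumes g: "g \<in> carrier G"
  shows "first_letter_mult g [] = []"
  using word_group_inj[OF cayley_machine_Bij[OF one_closed]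
      word_group_closed[OF first_letter_mult_closed[OF g]], of "[]" "[]"]
    cayley_fun_first_letter_mult[OF g, of "[]"]
  by (simp add: mealy_function_def)

text \<open>Through this homomorphism, \<open>order G\<close> bounds the orders of the elements
  \<open>first_letter_mult g\<close> when \<open>G\<close> is finite.\<close>

lemma first_letter_mult_hom: "group_hom G word_group first_letter_mult"
proof -
  have "first_letter_mult (g \<otimes> h) = first_letter_mult g \<otimes>\<^bsub>word_group\<^esub> first_letter_mult h"
    if gh: "g \<in> carrier G" "h \<in> carrier G" for g h
  proof (rule word_group_eqI)
    interpret S: group word_group by (rule group_BijGroup)
    show "first_letter_mult (g \<otimes> h) \<in> carrier word_group"
      "first_letter_mult g \<otimes>\<^bsub>word_group\<^esub> first_letter_mult h \<in> carrier word_group"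
      using gh by (simp_all add: first_letter_mult_closed)
    fix w assume w: "w \<in> lists (carrier G)"
    show "first_letter_mult (g \<otimes> h) w = (first_letter_mult g \<otimes>\<^bsub>word_group\<^esub> first_letter_mult h) w"
      unfolding mult_word_group[OF gh[THEN first_letter_mult_closed] w]
      using gh w by (cases w) (auto simp: first_letter_mult_Nil first_letter_mult_apply m_assoc)
  qed
  then show ?thesis
    by (auto simp: group_hom_def group_hom_axioms_def hom_def first_letter_mult_closed
        group_BijGroup is_group)
qed

lemma cayley_fun_one_singleton:
  assumes "a \<in> carrier G"
  shows "(cayley_fun \<one> [^]\<^bsub>word_group\<^esub> (n::nat)) [a] = [a]"
proof (induction n)
  case 0
  then show ?case using assms by (simp add: BijGroup_def)
next
  case (Suc n)
  interpret S: group word_group by (rule group_BijGroup)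
  have "cayley_fun \<one> [a] = [a]" using assms by (simp add: mealy_function_def)
  with Suc assms show ?case
    by (simp add: mult_word_group cayley_machine_Bij)
qed

section \<open>Infinite order of the function of the state \<open>\<one>\<close>\<close>

text \<open>The inverse of \<open>cayley_fun \<one>\<close> sends \<open>(b\<^sub>0, b\<^sub>1, b\<^sub>2, \<dots>)\<close> to
  \<open>(b\<^sub>0, b\<^sub>0\<inverse> b\<^sub>1, b\<^sub>1\<inverse> b\<^sub>2, \<dots>)\<close>, hence it moves the last nontrivial letter of a word one step to
  the right, as long as there is room.\<close>

definition last_nontrivial :: "nat \<Rightarrow> 'a list \<Rightarrow> bool" where
  "last_nontrivial k w \<longleftrightarrow> w ! k \<noteq> \<one> \<and> (\<forall>i. k < i \<longrightarrow> i < length w \<longrightarrow> w ! i = \<one>)"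

text \<open>The output letters are the prefix products of \<open>v\<close>.\<close>

lemma cayley_fun_one_nth_Suc:
  assumes v: "v \<in> lists (carrier G)" and i: "Suc i < length v"
  shows "cayley_fun \<one> v ! Suc i = cayley_fun \<one> v ! i \<otimes> v ! Suc i"
  using v i
  by (simp add: mealy_function_def cayley_machine_nth take_Suc_conv_app_nth del: in_lists_conv_set)

text \<open>Stated as a pullback along \<open>cayley_fun \<one>\<close>, which avoids computing the
  inverse. A letter after the first is trivial exactly when the prefix products before and after it
  agree: they differ at \<open>Suc k\<close> and are both \<open>\<one>\<close> beyond it.\<close>

lemma last_nontrivial_pull:
  assumes v: "v \<in> lists (carrier G)" and k: "Suc k < length v"
    and w: "last_nontrivial k (cayley_fun \<one> v)"
  shows "last_nontrivial (Suc k) v"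
proof -
  have len: "length (cayley_fun \<one> v) = length v" using v by (simp add: mealy_function_def)
  have clo: "v ! i \<in> carrier G" "cayley_fun \<one> v ! i \<in> carrier G" if "i < length v" for i
    using that v word_group_closed[OF cayley_machine_Bij[OF one_closed] v] len
    by (metis in_listsD nth_mem)+
  have "v ! Suc k \<noteq> \<one>"
  proof
    assume "v ! Suc k = \<one>"
    then have "cayley_fun \<one> v ! Suc k = cayley_fun \<one> v ! k"
      using cayley_fun_one_nth_Suc[OF v k] clo k by simp
    with w k len show False by (simp add: last_nontrivial_def)
  qed
  moreover have "v ! i = \<one>" if i: "Suc k < i" "i < length v" for i
  proof -
    obtain j where j: "i = Suc j" "k < j" using i(1) by (cases i) auto
    then show ?thesis
      using cayley_fun_one_nth_Suc[OF v, of j] clo[of i] w len i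
      by (simp add: last_nontrivial_def)
  qed
  ultimately show ?thesis by (simp add: last_nontrivial_def)
qed

lemma last_nontrivial_pull_pow:
  assumes v: "v \<in> lists (carrier G)" and n: "n < length v"
    and w: "last_nontrivial 0 ((cayley_fun \<one> [^]\<^bsub>word_group\<^esub> n) v)"
  shows "last_nontrivial n v"
  using assms
proof (induction n arbitrary: v)
  case 0
  then show ?case by (simp add: BijGroup_def)
next
  case (Suc n)
  interpret S: group word_group by (rule group_BijGroup)
  let ?v = "cayley_fun \<one> v"
  have t: "cayley_fun \<one> \<in> carrier word_group" by (simp add: cayley_machine_Bij)
  \<comment> \<open>The factor split off acts first, so the induction hypothesis is used at
    \<open>?v\<close>, not at \<open>v\<close>.\<close>
  have "(cayley_fun \<one> [^]\<^bsub>word_group\<^esub> Suc n) v = (cayley_fun \<one> [^]\<^bsub>word_group\<^esub> n) ?v"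
    using mult_word_group[OF S.nat_pow_closed[OF t] t Suc.prems(1)] by simp
  moreover have "length ?v = length v"
    using Suc.prems(1) by (simp add: mealy_function_def)
  ultimately have "last_nontrivial n ?v"
    using Suc.IH[OF word_group_closed[OF t Suc.prems(1)]] Suc.prems by simp
  then show ?case using last_nontrivial_pull Suc.prems by simp
qed

text \<open>A trivial \<open>n\<close>-th power would fix \<open>a\<close> followed by
  \<open>n\<close> trivial letters. Its last nontrivial letter, at position 0, would then also be at
  position \<open>n\<close>, for which the length \<open>n + 1\<close> just leaves room.\<close>

lemma cayley_fun_one_pow_neq_one:
  assumes a: "a \<in> carrier G" "a \<noteq> \<one>" and n: "0 < n"
  shows "cayley_fun \<one> [^]\<^bsub>word_group\<^esub> (n::nat) \<noteq> \<one>\<^bsub>word_group\<^esub>"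
proof
  assume eq: "cayley_fun \<one> [^]\<^bsub>word_group\<^esub> n = \<one>\<^bsub>word_group\<^esub>"
  let ?w = "a # replicate n \<one>"
  have w: "?w \<in> lists (carrier G)" using a by auto
  then have "(cayley_fun \<one> [^]\<^bsub>word_group\<^esub> n) ?w = ?w"
    unfolding eq by (simp add: BijGroup_def)
  moreover have "last_nontrivial 0 ?w"
    using a by (auto simp: last_nontrivial_def nth_Cons')
  ultimately have "last_nontrivial n ?w"
    using last_nontrivial_pull_pow[OF w, of n] by simp
  with n show False by (simp add: last_nontrivial_def nth_Cons')
qed

text \<open>The element \<open>z\<close> is a conjugate of \<open>first_letter_mult g\<close>. At
  the word \<open>[\<one>]\<close> the two products take the values \<open>[g \<otimes> h]\<close>
  and \<open>[h \<otimes> g]\<close>.\<close>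

lemma conjugate_first_letter_mult_not_commute:
  assumes g: "g \<in> carrier G" and h: "h \<in> carrier G" and gh: "g \<otimes> h \<noteq> h \<otimes> g"
    and z: "z \<in> carrier word_group"
      "z \<otimes>\<^bsub>word_group\<^esub> cayley_fun \<one> [^]\<^bsub>word_group\<^esub> (n::nat) =
        cayley_fun \<one> [^]\<^bsub>word_group\<^esub> n \<otimes>\<^bsub>word_group\<^esub> first_letter_mult g"
  shows "z \<otimes>\<^bsub>word_group\<^esub> first_letter_mult h \<noteq> first_letter_mult h \<otimes>\<^bsub>word_group\<^esub> z"
proof
  interpret S: group word_group by (rule group_BijGroup)
  let ?u = "cayley_fun \<one> [^]\<^bsub>word_group\<^esub> n"
  have u: "?u \<in> carrier word_group" by (simp add: cayley_machine_Bij)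
  have z_singleton: "z [a] = [g \<otimes> a]" if a: "a \<in> carrier G" for a
  proof -
    \<comment> \<open>The power \<open>?u\<close> fixes \<open>[a]\<close>, so inserting it changes
      nothing and makes the equation for \<open>z\<close> applicable.\<close>
    have "z [a] = (z \<otimes>\<^bsub>word_group\<^esub> ?u) [a]"
      using a mult_word_group[OF z(1) u, of "[a]"] by (simp add: cayley_fun_one_singleton)
    also have "\<dots> = [g \<otimes> a]"
      unfolding z(2) using a g mult_word_group[OF u first_letter_mult_closed[OF g], of "[a]"]
      by (simp add: cayley_fun_one_singleton first_letter_mult_apply)
    finally show ?thesis .
  qed
  assume "z \<otimes>\<^bsub>word_group\<^esub> first_letter_mult h = first_letter_mult h \<otimes>\<^bsub>word_group\<^esub> z"
  then have "z (first_letter_mult h [\<one>]) = first_letter_mult h (z [\<one>])"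
    using mult_word_group[OF z(1) first_letter_mult_closed[OF h], of "[\<one>]"]
      mult_word_group[OF first_letter_mult_closed[OF h] z(1), of "[\<one>]"] by simp
  with gh show False
    using g h by (simp add: first_letter_mult_apply z_singleton)
qed

section \<open>The automaton group and its embeddings\<close>

lemma automaton_group_cayley_machine:
  "automaton_group (cayley_machine G) = subgroup_generated word_group (cayley_fun ` carrier G)"
  by (simp add: automaton_group_def)

lemma cayley_fun_in_automaton_group:
  assumes "g \<in> carrier G"
  shows "cayley_fun g \<in> carrier (automaton_group (cayley_machine G))"
  unfolding automaton_group_cayley_machine carrier_subgroup_generated
  using assms by (auto intro: generate.incl simp: cayley_machine_Bij)

lemma group_automaton_group_cayley_machine: "group (automaton_group (cayley_machine G))"
  unfolding automaton_group_cayley_machine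
  by (rule group.group_subgroup_generated[OF group_BijGroup])

lemma first_letter_mult_in_automaton_group:
  assumes "g \<in> carrier G"
  shows "first_letter_mult g \<in> carrier (automaton_group (cayley_machine G))"
proof -
  interpret A: group "automaton_group (cayley_machine G)"
    by (rule group_automaton_group_cayley_machine)
  have "first_letter_mult g = inv\<^bsub>automaton_group (cayley_machine G)\<^esub> (cayley_fun \<one>)
          \<otimes>\<^bsub>automaton_group (cayley_machine G)\<^esub> cayley_fun g"
    using cayley_fun_in_automaton_group[OF one_closed]
      group.inv_subgroup_generated[OF group_BijGroup, of "cayley_fun \<one>"]
    by (simp add: first_letter_mult_def automaton_group_cayley_machine)
  then show ?thesis using assms by (simp add: cayley_fun_in_automaton_group)
qed

lemma cayley_automaton_group_not_embed_wreath_product: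
  assumes fin: "finite (carrier G)"
    and g: "g \<in> carrier G" and h: "h \<in> carrier G" and gh: "g \<otimes> h \<noteq> h \<otimes> g"
    and K: "group K" "finite (carrier K)" and H: "group H" "torsion_free H"
  shows "\<phi> \<notin> mon (automaton_group (cayley_machine G)) (wreath_product K H)"
proof
  assume \<phi>: "\<phi> \<in> mon (automaton_group (cayley_machine G)) (wreath_product K H)"
  let ?A = "automaton_group (cayley_machine G)" and ?W = "wreath_product K H"
  let ?t = "cayley_fun \<one>"
  interpret phi: group_hom ?A ?W \<phi>
    using \<phi> group_automaton_group_cayley_machine group_wreath_product[OF K(1) H(1)]
    by (simp add: group_hom_def group_hom_axioms_def mon_def)
  interpret lam: group_hom G word_group first_letter_mult by (rule first_letter_mult_hom)
  have inj: "inj_on \<phi> (carrier ?A)" using \<phi> by (simp add: mon_def)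
  have A_mult: "(\<otimes>\<^bsub>?A\<^esub>) = (\<otimes>\<^bsub>word_group\<^esub>)" and A_one: "\<one>\<^bsub>?A\<^esub> = \<one>\<^bsub>word_group\<^esub>"
    by (simp_all add: automaton_group_cayley_machine)
  have A_pow: "x [^]\<^bsub>?A\<^esub> (n::nat) = x [^]\<^bsub>word_group\<^esub> n" for x n
    by (simp add: automaton_group_cayley_machine pow_subgroup_generated)
  have A_sub: "x \<in> carrier word_group" if "x \<in> carrier ?A" for x
    using that group.carrier_subgroup_generated_subset[OF group_BijGroup]
    unfolding automaton_group_cayley_machine by blast
  note t = cayley_fun_in_automaton_group[OF one_closed]
  have g1: "g \<noteq> \<one>" using g h gh by auto
  \<comment> \<open>Injectivity of \<open>\<phi>\<close> preserves infinite order; the nontrivial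
    letter required is \<open>g\<close>.\<close>
  have t_order: "\<phi> ?t [^]\<^bsub>?W\<^esub> n \<noteq> \<one>\<^bsub>?W\<^esub>" if "0 < n" for n :: nat
  proof
    assume "\<phi> ?t [^]\<^bsub>?W\<^esub> n = \<one>\<^bsub>?W\<^esub>"
    then have "\<phi> (?t [^]\<^bsub>?A\<^esub> n) = \<phi> \<one>\<^bsub>?A\<^esub>" using phi.hom_nat_pow[OF t] by simp
    then have "?t [^]\<^bsub>?A\<^esub> n = \<one>\<^bsub>?A\<^esub>"
      using inj_onD[OF inj] t by blast
    with cayley_fun_one_pow_neq_one[OF g g1 that] show False by (simp add: A_pow A_one)
  qed
  have torsion: "\<phi> (first_letter_mult x) [^]\<^bsub>?W\<^esub> order G = \<one>\<^bsub>?W\<^esub>" if x: "x \<in> carrier G" for x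
  proof -
    have "first_letter_mult x [^]\<^bsub>?A\<^esub> order G = \<one>\<^bsub>?A\<^esub>"
      using lam.hom_nat_pow[OF x, of "order G"] pow_order_eq_1[OF x] by (simp add: A_pow A_one)
    then show ?thesis
      using phi.hom_nat_pow[OF first_letter_mult_in_automaton_group[OF x], of "order G"] by simp
  qed
  have "0 < order G" using fin order_gt_0_iff_finite by simp
  then obtain n :: nat and z where z: "z \<in> carrier ?W"
    "z \<otimes>\<^bsub>?W\<^esub> \<phi> ?t [^]\<^bsub>?W\<^esub> n = \<phi> ?t [^]\<^bsub>?W\<^esub> n \<otimes>\<^bsub>?W\<^esub> \<phi> (first_letter_mult g)"
    "z \<otimes>\<^bsub>?W\<^esub> \<phi> (first_letter_mult h) = \<phi> (first_letter_mult h) \<otimes>\<^bsub>?W\<^esub> z"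
    using conjugate_commutes_with_torsion[OF K H phi.hom_closed[OF t] t_order
        phi.hom_closed[OF first_letter_mult_in_automaton_group[OF g]] _ torsion[OF g]
        phi.hom_closed[OF first_letter_mult_in_automaton_group[OF h]] _ torsion[OF h]]
    by metis
  \<comment> \<open>A preimage of \<open>z\<close>: it is the same conjugate formed before applying
    \<open>\<phi>\<close>. Cancelling the power of \<open>\<phi> ?t\<close> gives
    \<open>\<phi> y = z\<close>, and injectivity pulls the commutation back.\<close>
  define y where "y = ?t [^]\<^bsub>?A\<^esub> n \<otimes>\<^bsub>?A\<^esub> first_letter_mult g \<otimes>\<^bsub>?A\<^esub> inv\<^bsub>?A\<^esub> (?t [^]\<^bsub>?A\<^esub> n)"
  have tn: "?t [^]\<^bsub>?A\<^esub> n \<in> carrier ?A" using t by simp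
  note lg = first_letter_mult_in_automaton_group[OF g]
    and lh = first_letter_mult_in_automaton_group[OF h]
  have y: "y \<in> carrier ?A" using tn lg by (simp add: y_def)
  have yt: "y \<otimes>\<^bsub>?A\<^esub> ?t [^]\<^bsub>?A\<^esub> n = ?t [^]\<^bsub>?A\<^esub> n \<otimes>\<^bsub>?A\<^esub> first_letter_mult g"
    using tn lg by (simp add: y_def phi.G.m_assoc)
  have "\<phi> y \<otimes>\<^bsub>?W\<^esub> \<phi> ?t [^]\<^bsub>?W\<^esub> n = \<phi> ?t [^]\<^bsub>?W\<^esub> n \<otimes>\<^bsub>?W\<^esub> \<phi> (first_letter_mult g)"
    using arg_cong[OF yt, of \<phi>] y tn lg t by (simp add: phi.hom_nat_pow)
  with z(2) have "\<phi> y = z"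
    using z(1) y t phi.H.right_cancel[of "\<phi> ?t [^]\<^bsub>?W\<^esub> n" "\<phi> y" z] by simp
  with z(3) have "\<phi> (y \<otimes>\<^bsub>?A\<^esub> first_letter_mult h) = \<phi> (first_letter_mult h \<otimes>\<^bsub>?A\<^esub> y)"
    using y lh by simp
  then have "y \<otimes>\<^bsub>?A\<^esub> first_letter_mult h = first_letter_mult h \<otimes>\<^bsub>?A\<^esub> y"
    using inj_onD[OF inj] y lh by blast
  moreover have "y \<otimes>\<^bsub>word_group\<^esub> first_letter_mult h \<noteq> first_letter_mult h \<otimes>\<^bsub>word_group\<^esub> y"
    using conjugate_first_letter_mult_not_commute[OF g h gh A_sub[OF y], of n] yt
    by (simp add: A_mult A_pow)
  ultimately show False by (simp add: A_mult)
qed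

end

theorem theorem6p5:
  fixes G :: "('a, 'm) monoid_scheme"
    and K :: "('b, 'k) monoid_scheme"
    and H :: "('c, 'l) monoid_scheme"
  assumes "group G" and "finite (carrier G)"
    and "\<exists>x\<in>carrier G. x \<notin> group_center G \<and> odd (group.ord G x)"
    and "group K" and "finite (carrier K)"
    and "group H" and "torsion_free H"
  shows "\<not> (\<exists>\<phi>. \<phi> \<in> mon (automaton_group (cayley_machine G)) (wreath_product K H))"
proof -
  obtain g h where "g \<in> carrier G" "h \<in> carrier G" "g \<otimes>\<^bsub>G\<^esub> h \<noteq> h \<otimes>\<^bsub>G\<^esub> g"
    using assms(3) by (auto simp: group_center_def)
  then show ?thesis
    using group.cayley_automaton_group_not_embed_wreath_product[OF assms(1,2) _ _ _ assms(4-7)]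
    by blast
qed

end
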